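(* Let $(M,d)$ be a generalized metric space and $\{f_n\}$, $f_n:[a,b]\to M$, a sequence of oriented-equicontinuous functions. Suppose that $\{f_n(a)\}$ has an accumulation point and that $(M,d)$ is locally compact and complete. Then there exist a continuous function $f:[a,b]\to M$ and an equicontinuous subsequence $\{f_{n_k}\}\subset\{f_n\}$ such that $\{f_{n_k}(t)\}\to f(t)$ for each $t\in[a,b]$.
   Context: A generalized metric space $(M,d)$ is a set with a map $d:M\times M\to\mathbb R$ satisfying: $d\ge0$; $d(x,y)=d(y,x)=0$ iff $x=y$; $d(x,z)\le d(x,y)+d(y,z)$; and for any sequence $\{x_n\}$ and $x\in M$, $d(x_n,x)\to0$ iff $d(x,x_n)\to0$. Its topology is generated by the forward open balls $\{y:d(x,y)<r\}$ (equivalently, by the backward ones), and $x_n\to x$ iff $d(x_n,x)\to0$. Complete means (forward) complete: every sequence such that for all $\epsilon>0$ there is $n_0$ with $d(x_n,x_m)<\epsilon$ whenever $n_0\le n\le m$ is convergent in $M$. A sequence $f_n:[a,b]\to M$ is oriented-equicontinuous if for any $\epsilon>0$ there is $\delta>0$ such that for any $t_1,t_2\in[a,b]$ with $0\le t_2-t_1<\delta$ one has $d(f_n(t_1),f_n(t_2))<\epsilon$ for all $n$. It is equicontinuous if the same holds with the requirement $0\le t_2-t_1<\delta$ weakened to $0\le|t_2-t_1|<\delta$. *)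

theory Defs
  imports "HOL-Analysis.Analysis"
begin

locale generalized_metric_space =
  fixes M :: "'a set" and d :: "'a \<Rightarrow> 'a \<Rightarrow> real"
  assumes nonneg: "\<lbrakk>x \<in> M; y \<in> M\<rbrakk> \<Longrightarrow> 0 \<le> d x y"
    and zero_iff: "\<lbrakk>x \<in> M; y \<in> M\<rbrakk> \<Longrightarrow> (d x y = 0 \<and> d y x = 0) \<longleftrightarrow> x = y"
    and triangle: "\<lbrakk>x \<in> M; y \<in> M; z \<in> M\<rbrakk> \<Longrightarrow> d x z \<le> d x y + d y z"
    and tendsto_zero_iff: "\<lbrakk>range s \<subseteq> M; x \<in> M\<rbrakk> \<Longrightarrow>
      ((\<lambda>n. d (s n) x) \<longlonglongrightarrow> 0) \<longleftrightarrow> ((\<lambda>n. d x (s n)) \<longlonglongrightarrow> 0)"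

definition forward_ball :: "'a set \<Rightarrow> ('a \<Rightarrow> 'a \<Rightarrow> real) \<Rightarrow> 'a \<Rightarrow> real \<Rightarrow> 'a set"
  where "forward_ball M d x r = {y \<in> M. d x y < r}"

definition gm_topology :: "'a set \<Rightarrow> ('a \<Rightarrow> 'a \<Rightarrow> real) \<Rightarrow> 'a topology"
  where "gm_topology M d = topology_generated_by {forward_ball M d x r | x r. x \<in> M \<and> 0 < r}"

definition forward_Cauchy :: "('a \<Rightarrow> 'a \<Rightarrow> real) \<Rightarrow> (nat \<Rightarrow> 'a) \<Rightarrow> bool"
  where "forward_Cauchy d s \<longleftrightarrow>
    (\<forall>\<epsilon>>0. \<exists>n0. \<forall>n m. n0 \<le> n \<and> n \<le> m \<longrightarrow> d (s n) (s m) < \<epsilon>)"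

definition forward_complete :: "'a set \<Rightarrow> ('a \<Rightarrow> 'a \<Rightarrow> real) \<Rightarrow> bool"
  where "forward_complete M d \<longleftrightarrow>
    (\<forall>s. range s \<subseteq> M \<and> forward_Cauchy d s \<longrightarrow>
      (\<exists>x. limitin (gm_topology M d) s x sequentially))"

text \<open>Accumulation (cluster) point of a sequence, not of its range: terms are counted by index,
  so a value attained infinitely often is an accumulation point.\<close>
definition seq_accumulation_point :: "'a topology \<Rightarrow> (nat \<Rightarrow> 'a) \<Rightarrow> 'a \<Rightarrow> bool"
  where "seq_accumulation_point X s p \<longleftrightarrow>
    p \<in> topspace X \<and> (\<forall>U. openin X U \<and> p \<in> U \<longrightarrow> infinite {n. s n \<in> U})"

definition oriented_equicontinuous ::
    "('a \<Rightarrow> 'a \<Rightarrow> real) \<Rightarrow> real \<Rightarrow> real \<Rightarrow> (nat \<Rightarrow> real \<Rightarrow> 'a) \<Rightarrow> bool"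
  where "oriented_equicontinuous d a b f \<longleftrightarrow>
    (\<forall>\<epsilon>>0. \<exists>\<delta>>0. \<forall>t1\<in>{a..b}. \<forall>t2\<in>{a..b}.
      0 \<le> t2 - t1 \<and> t2 - t1 < \<delta> \<longrightarrow> (\<forall>n. d (f n t1) (f n t2) < \<epsilon>))"

definition equicontinuous ::
    "('a \<Rightarrow> 'a \<Rightarrow> real) \<Rightarrow> real \<Rightarrow> real \<Rightarrow> (nat \<Rightarrow> real \<Rightarrow> 'a) \<Rightarrow> bool"
  where "equicontinuous d a b f \<longleftrightarrow>
    (\<forall>\<epsilon>>0. \<exists>\<delta>>0. \<forall>t1\<in>{a..b}. \<forall>t2\<in>{a..b}.
      0 \<le> \<bar>t2 - t1\<bar> \<and> \<bar>t2 - t1\<bar> < \<delta> \<longrightarrow> (\<forall>n. d (f n t1) (f n t2) < \<epsilon>))"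

context generalized_metric_space
begin

lemma d_self: "x \<in> M \<Longrightarrow> d x x = 0"
  using zero_iff[of x x] by simp

lemma topspace_gm_topology: "topspace (gm_topology M d) = M"
  unfolding gm_topology_def topology_generated_by_topspace
proof (intro set_eqI iffI)
  fix y assume "y \<in> M"
  then have "y \<in> forward_ball M d y 1"
    by (simp add: forward_ball_def d_self)
  with \<open>y \<in> M\<close> show "y \<in> \<Union> {forward_ball M d x r | x r. x \<in> M \<and> 0 < r}"
    using zero_less_one by blast
qed (auto simp: forward_ball_def)

lemma openin_gm_topology:
  "openin (gm_topology M d) U \<longleftrightarrow> U \<subseteq> M \<and> (\<forall>x\<in>U. \<exists>r>0. forward_ball M d x r \<subseteq> U)"
proof
  assume U: "openin (gm_topology M d) U"
  have "\<forall>x\<in>U. \<exists>r>0. forward_ball M d x r \<subseteq> U"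
    using U unfolding gm_topology_def openin_topology_generated_by_iff
  proof (induction rule: generate_topology_on.induct)
    case (Int A B)
    show ?case
    proof
      fix x assume "x \<in> A \<inter> B"
      then obtain r s where "r > 0" "forward_ball M d x r \<subseteq> A" "s > 0" "forward_ball M d x s \<subseteq> B"
        using Int by blast
      then have "min r s > 0" "forward_ball M d x (min r s) \<subseteq> A \<inter> B"
        by (auto simp: forward_ball_def)
      then show "\<exists>r>0. forward_ball M d x r \<subseteq> A \<inter> B" by blast
    qed
  next
    case (UN K)
    then show ?case by (meson Union_iff Union_upper subset_trans)
  next
    case (Basis S)
    then obtain z r where S: "S = forward_ball M d z r" "z \<in> M" by blast
    show ?case
    proof
      fix x assume x: "x \<in> S"
      have "forward_ball M d x (r - d z x) \<subseteq> S"
      proof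
        fix y assume "y \<in> forward_ball M d x (r - d z x)"
        then show "y \<in> S"
          using S x triangle[of z x y] by (auto simp: forward_ball_def)
      qed
      moreover have "r - d z x > 0" using x S by (simp add: forward_ball_def)
      ultimately show "\<exists>r>0. forward_ball M d x r \<subseteq> S" by blast
    qed
  qed auto
  then show "U \<subseteq> M \<and> (\<forall>x\<in>U. \<exists>r>0. forward_ball M d x r \<subseteq> U)"
    using openin_subset[OF U] topspace_gm_topology by simp
next
  assume R: "U \<subseteq> M \<and> (\<forall>x\<in>U. \<exists>r>0. forward_ball M d x r \<subseteq> U)"
  show "openin (gm_topology M d) U"
  proof (subst openin_subopen, intro ballI)
    fix x assume x: "x \<in> U"
    then obtain r where r: "r > 0" "forward_ball M d x r \<subseteq> U" using R by blast
    have "x \<in> M" using x R by blast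
    then have "openin (gm_topology M d) (forward_ball M d x r)"
      unfolding gm_topology_def using r by (intro topology_generated_by_Basis) blast
    moreover have "x \<in> forward_ball M d x r"
      using \<open>x \<in> M\<close> r d_self by (simp add: forward_ball_def)
    ultimately show "\<exists>T. openin (gm_topology M d) T \<and> x \<in> T \<and> T \<subseteq> U" using r by blast
  qed
qed

lemma limitin_gm_topology:
  assumes s: "range s \<subseteq> M"
  shows "limitin (gm_topology M d) s x sequentially \<longleftrightarrow> x \<in> M \<and> (\<lambda>n. d (s n) x) \<longlonglongrightarrow> 0"
proof (cases "x \<in> M")
  case True
  have sM: "s n \<in> M" for n using s by blast
  have "limitin (gm_topology M d) s x sequentially \<longleftrightarrow> (\<lambda>n. d x (s n)) \<longlonglongrightarrow> 0"
  proof
    assume L: "limitin (gm_topology M d) s x sequentially"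
    show "(\<lambda>n. d x (s n)) \<longlonglongrightarrow> 0"
    proof (rule tendstoI)
      fix e :: real assume "e > 0"
      then have "openin (gm_topology M d) (forward_ball M d x e)" "x \<in> forward_ball M d x e"
        using True d_self unfolding gm_topology_def
        by (auto simp: forward_ball_def intro!: topology_generated_by_Basis)
      then have "\<forall>\<^sub>F n in sequentially. s n \<in> forward_ball M d x e"
        using L by (simp add: limitin_def)
      then show "\<forall>\<^sub>F n in sequentially. dist (d x (s n)) 0 < e"
        by eventually_elim (use True nonneg in \<open>auto simp: forward_ball_def\<close>)
    qed
  next
    assume L: "(\<lambda>n. d x (s n)) \<longlonglongrightarrow> 0"
    show "limitin (gm_topology M d) s x sequentially"
      unfolding limitin_def topspace_gm_topology
    proof (intro conjI allI impI)
      fix U assume "openin (gm_topology M d) U \<and> x \<in> U"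
      then obtain r where r: "r > 0" "forward_ball M d x r \<subseteq> U"
        using openin_gm_topology by blast
      have "\<forall>\<^sub>F n in sequentially. d x (s n) < r" using order_tendstoD(2)[OF L r(1)] .
      then show "\<forall>\<^sub>F n in sequentially. s n \<in> U"
        by eventually_elim (use r sM in \<open>auto simp: forward_ball_def\<close>)
    qed (use True in simp)
  qed
  then show ?thesis using True tendsto_zero_iff[OF s True] by simp
next
  case False
  then show ?thesis by (simp add: limitin_def topspace_gm_topology)
qed

end

end

theory Submission
  imports Defs "HOL-Library.Diagonal_Subsequence"
begin

text \<open>The symmetrization of d is a metric with the same topology, and d-closeness to a fixed point,
  on either side, forces closeness in this metric; over a compact set of limits this makes oriented
  equicontinuity two-sided. It remains to see that the values at each time are relatively compact.
  The set of such times contains a after passing to a subsequence. It is open to the right because of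
  local compactness and oriented equicontinuity. If times increase to t, limits at these times
  (along a diagonal subsequence) form a forward Cauchy sequence, and by completeness the values at t
  converge to its limit. Hence the set is all of [a,b], and the usual Arzela--Ascoli argument
  applies.\<close>

section \<open>Symmetrizing the generalized metric\<close>

context generalized_metric_space
begin

text \<open>The absolute values change nothing on \<open>M\<close>. They give nonnegativity and
  domination of \<open>d\<close> on the whole type, and \<open>Metric_space\<close> demands the
  former even outside its carrier.\<close>

definition sdist :: "'a \<Rightarrow> 'a \<Rightarrow> real"
  where "sdist x y = \<bar>d x y\<bar> + \<bar>d y x\<bar>"

lemma sdist_eq: "x \<in> M \<Longrightarrow> y \<in> M \<Longrightarrow> sdist x y = d x y + d y x"
  by (simp add: sdist_def nonneg)

lemma d_le_sdist: "d x y \<le> sdist x y" "d y x \<le> sdist x y"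
  by (auto simp: sdist_def)

sublocale sym: Metric_space M sdist
proof
  fix x y assume M: "x \<in> M" "y \<in> M"
  then show "sdist x y = 0 \<longleftrightarrow> x = y"
    using nonneg[of x y] nonneg[of y x] zero_iff[of x y] by (simp add: sdist_eq add_nonneg_eq_0_iff)
next
  fix x y z assume "x \<in> M" "y \<in> M" "z \<in> M"
  then show "sdist x z \<le> sdist x y + sdist y z"
    using triangle[of x y z] triangle[of z y x] by (simp add: sdist_eq)
qed (auto simp: sdist_def)

text \<open>This is the axiom \<open>tendsto_zero_iff\<close> in epsilon-delta form, with
  \<open>\<delta>\<close> depending on \<open>y\<close>. If no \<open>\<delta>\<close> worked,
  points with one distance below 1/(n+1) and the other at least e/2 would form a sequence violating
  the axiom.\<close>

lemma sdist_small:
  assumes y: "y \<in> M" and e: "0 < e"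
  obtains \<delta> where "0 < \<delta>" "\<And>x. x \<in> M \<Longrightarrow> d x y < \<delta> \<or> d y x < \<delta> \<Longrightarrow> sdist x y < e"
proof -
  \<comment> \<open>\<open>g\<close> and \<open>h\<close> stand for the distances to and from
    \<open>y\<close>; the claim is used once in each order.\<close>
  have "\<exists>\<delta>>0. \<forall>x\<in>M. g x < \<delta> \<longrightarrow> h x < e / 2"
    if gh: "\<And>s. range s \<subseteq> M \<Longrightarrow> (\<lambda>n. g (s n)) \<longlonglongrightarrow> 0 \<Longrightarrow> (\<lambda>n. h (s n)) \<longlonglongrightarrow> 0"
      and g: "\<And>x. x \<in> M \<Longrightarrow> 0 \<le> g x" for g h :: "'a \<Rightarrow> real"
  proof (rule ccontr)
    assume "\<not> ?thesis"
    then have "\<exists>x\<in>M. g x < inverse (real (Suc n)) \<and> e / 2 \<le> h x" for n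
      by (meson inverse_positive_iff_positive of_nat_0_less_iff zero_less_Suc not_le)
    then obtain s where s: "\<And>n. s n \<in> M" "\<And>n. g (s n) < inverse (real (Suc n))" "\<And>n. e / 2 \<le> h (s n)"
      by metis
    have "(\<lambda>n. g (s n)) \<longlonglongrightarrow> 0"
      by (rule real_tendsto_sandwich[OF _ _ tendsto_const LIMSEQ_inverse_real_of_nat])
        (use s g in \<open>auto intro!: always_eventually less_imp_le\<close>)
    then have "(\<lambda>n. h (s n)) \<longlonglongrightarrow> 0" using gh s by blast
    then have "e / 2 \<le> 0" using s by (intro LIMSEQ_le_const) auto
    then show False using e by simp
  qed
  note * = this
  obtain \<delta>1 where 1: "\<delta>1 > 0" "\<And>x. x \<in> M \<Longrightarrow> d x y < \<delta>1 \<Longrightarrow> d y x < e / 2"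
    using *[of "\<lambda>x. d x y" "\<lambda>x. d y x"] tendsto_zero_iff[OF _ y] nonneg[OF _ y] by blast
  obtain \<delta>2 where 2: "\<delta>2 > 0" "\<And>x. x \<in> M \<Longrightarrow> d y x < \<delta>2 \<Longrightarrow> d x y < e / 2"
    using *[of "\<lambda>x. d y x" "\<lambda>x. d x y"] tendsto_zero_iff[OF _ y] nonneg[OF y] by blast
  show thesis
  proof
    show "0 < min (e / 2) (min \<delta>1 \<delta>2)" using 1 2 e by simp
    show "sdist x y < e" if "x \<in> M" "d x y < min (e / 2) (min \<delta>1 \<delta>2) \<or> d y x < min (e / 2) (min \<delta>1 \<delta>2)" for x
      using 1(2)[of x] 2(2)[of x] that y by (auto simp: sdist_eq)
  qed
qed

text \<open>Symmetric balls lie in forward balls because \<open>d\<close> is at most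
  \<open>sdist\<close>; \<open>sdist_small\<close> puts a forward ball inside each symmetric ball.
  From here on, limits and compactness are those of a metric space.\<close>

lemma gm_topology_eq: "gm_topology M d = sym.mtopology"
proof -
  have "(\<exists>r>0. forward_ball M d x r \<subseteq> U) \<longleftrightarrow> (\<exists>r>0. sym.mball x r \<subseteq> U)" if "x \<in> M" for x U
  proof
    assume "\<exists>r>0. forward_ball M d x r \<subseteq> U"
    moreover have "sym.mball x r \<subseteq> forward_ball M d x r" for r
      using le_less_trans[OF d_le_sdist(1)] by (auto simp: forward_ball_def sym.mball_def)
    ultimately show "\<exists>r>0. sym.mball x r \<subseteq> U" by (auto intro: subset_trans)
  next
    assume "\<exists>r>0. sym.mball x r \<subseteq> U"
    then obtain r where r: "0 < r" "sym.mball x r \<subseteq> U" by (elim exE conjE)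
    obtain \<delta> where \<delta>: "0 < \<delta>" "\<And>y. y \<in> M \<Longrightarrow> d y x < \<delta> \<or> d x y < \<delta> \<Longrightarrow> sdist y x < r"
      using sdist_small[OF \<open>x \<in> M\<close> r(1)] by metis
    have "forward_ball M d x \<delta> \<subseteq> sym.mball x r"
      using \<delta>(2) \<open>x \<in> M\<close> unfolding forward_ball_def sym.mball_def by (auto simp only: sym.commute[of x] mem_Collect_eq)
    then show "\<exists>r>0. forward_ball M d x r \<subseteq> U" using \<delta>(1) subset_trans[OF _ r(2)] by auto
  qed
  note balls = this
  have "openin (gm_topology M d) U \<longleftrightarrow> openin sym.mtopology U" for U
    unfolding openin_gm_topology sym.openin_mtopology Ball_def
    by (intro conj_cong refl all_cong1 imp_cong balls) (rule subsetD)
  then show ?thesis unfolding topology_eq by (rule allI)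
qed

section \<open>Relative sequential compactness and extraction of subsequences\<close>

abbreviation converges :: "(nat \<Rightarrow> 'a) \<Rightarrow> 'a \<Rightarrow> bool"
  where "converges \<sigma> x \<equiv> limitin sym.mtopology \<sigma> x sequentially"

lemma converges_subseq: "converges \<sigma> x \<Longrightarrow> strict_mono r \<Longrightarrow> converges (\<lambda>k. \<sigma> (r k)) x"
  using limitin_subsequence[of r sym.mtopology \<sigma> x] by (simp add: o_def)

lemma convergesE:
  assumes "converges \<sigma> x" "0 < e"
  obtains N where "\<And>n. N \<le> n \<Longrightarrow> \<sigma> n \<in> M \<and> sdist (\<sigma> n) x < e"
  using assms unfolding sym.limit_metric_sequentially by blast

text \<open>The index map is arbitrary rather than increasing, so that the condition is relative
  compactness of the range and passes to arbitrary reindexings.\<close>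
definition rel_seq_compact :: "(nat \<Rightarrow> 'a) \<Rightarrow> bool"
  where "rel_seq_compact \<sigma> \<longleftrightarrow>
    (\<forall>n :: nat \<Rightarrow> nat. \<exists>r l. strict_mono (r :: nat \<Rightarrow> nat) \<and> converges (\<lambda>k. \<sigma> (n (r k))) l)"

lemma rel_seq_compactE:
  fixes n :: "nat \<Rightarrow> nat"
  assumes "rel_seq_compact \<sigma>"
  obtains r :: "nat \<Rightarrow> nat" and l where "strict_mono r" "converges (\<lambda>k. \<sigma> (n (r k))) l"
  using assms[unfolded rel_seq_compact_def, rule_format, of n] by (elim exE conjE)

lemma rel_seq_compact_if_compactin:
  assumes "compactin sym.mtopology K" "\<And>n. \<sigma> n \<in> K"
  shows "rel_seq_compact \<sigma>"
proof -
  have "\<exists>l r. l \<in> K \<and> strict_mono r \<and> converges ((\<lambda>k. \<sigma> (n k)) \<circ> r) l" for n :: "nat \<Rightarrow> nat"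
  proof -
    have "range (\<lambda>k. \<sigma> (n k)) \<subseteq> K" using assms(2) by blast
    then show ?thesis
      by (rule assms(1)[unfolded sym.compactin_sequentially, THEN conjunct2, rule_format])
  qed
  then show ?thesis unfolding rel_seq_compact_def o_def by fast
qed

text \<open>An arbitrary reindexing of \<open>\<sigma>\<close> need not be a subsequence, so its
  convergence is not inherited. Instead, the range together with the limit is compact.\<close>

lemma rel_seq_compact_if_converges:
  assumes "converges \<sigma> x" "range \<sigma> \<subseteq> M"
  shows "rel_seq_compact \<sigma>"
proof (rule rel_seq_compact_if_compactin)
  show "compactin sym.mtopology (insert x (range \<sigma>))"
    using assms by (intro compactin_sequence_with_limit) auto
qed simp

text \<open>Cantor's diagonal argument: compactness of the \<open>j\<close>-th sequence refines the
  indices chosen so far, and convergence survives further refinement.\<close>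

lemma diagonal_subseq:
  fixes n :: "nat \<Rightarrow> nat"
  assumes "\<And>j::nat. rel_seq_compact (\<sigma> j)"
  shows "\<exists>(r :: nat \<Rightarrow> nat) l. strict_mono r \<and> (\<forall>j. converges (\<lambda>k. \<sigma> j (n (r k))) (l j))"
proof -
  interpret subseqs "\<lambda>j s. \<exists>l. converges (\<lambda>k. \<sigma> j (n (s k))) l"
  proof
    fix j and s :: "nat \<Rightarrow> nat"
    show "\<exists>r'. strict_mono r' \<and> (\<exists>l. converges (\<lambda>k. \<sigma> j (n ((s \<circ> r') k))) l)"
      by (rule rel_seq_compactE[OF assms, of j "\<lambda>k. n (s k)"]) (unfold comp_apply, intro exI conjI)
  qed
  have "\<exists>l. converges (\<lambda>k. \<sigma> j (n (diagseq k))) l" for j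
  proof -
    \<comment> \<open>Only the tail of the diagonal from index \<open>Suc j\<close> on is sure to be
      a subsequence of the \<open>j\<close>-th refinement; the offset is removed afterwards.\<close>
    have "\<exists>l. converges (\<lambda>k. \<sigma> j (n ((diagseq \<circ> (+) (Suc j)) k))) l"
    proof (rule diagseq_holds)
      fix r s :: "nat \<Rightarrow> nat" and i
      assume r: "strict_mono r" and "\<exists>l. converges (\<lambda>k. \<sigma> i (n (s k))) l"
      then obtain l where "converges (\<lambda>k. \<sigma> i (n (s k))) l" by (elim exE)
      from converges_subseq[OF this r] show "\<exists>l. converges (\<lambda>k. \<sigma> i (n ((s \<circ> r) k))) l"
        unfolding comp_apply by (rule exI)
    qed
    then obtain l where "converges (\<lambda>k. \<sigma> j (n (diagseq (k + Suc j)))) l"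
      unfolding comp_apply add.commute[of "Suc j"] by (elim exE)
    then have "converges (\<lambda>k. \<sigma> j (n (diagseq k))) l"
      using limitin_sequentially_offset_rev[of sym.mtopology "\<lambda>k. \<sigma> j (n (diagseq k))" "Suc j"] by simp
    then show ?thesis ..
  qed
  then have "\<exists>l. \<forall>j. converges (\<lambda>k. \<sigma> j (n (diagseq k))) (l j)"
    by (intro choice allI)
  then show ?thesis using subseq_diagseq by (elim exE) (intro exI conjI)
qed

text \<open>The balls of radius 1/(k+1) around \<open>p\<close> each contain infinitely many terms
  by index, so each next index can be chosen beyond the previous one.\<close>

lemma accumulation_point_subseq:
  assumes p: "seq_accumulation_point (gm_topology M d) \<sigma> p"
  obtains r :: "nat \<Rightarrow> nat" where "strict_mono r" "converges (\<lambda>k. \<sigma> (r k)) p"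
proof -
  have pM: "p \<in> M" using p by (simp add: seq_accumulation_point_def topspace_gm_topology)
  have inf: "infinite {n. \<sigma> n \<in> sym.mball p e}" if "0 < e" for e
    using p[unfolded seq_accumulation_point_def gm_topology_eq, THEN conjunct2, rule_format, of "sym.mball p e"]
      that pM by simp
  have "\<exists>r. \<forall>k. \<sigma> (r k) \<in> sym.mball p (inverse (real (Suc k))) \<and> r k < r (Suc k)"
  proof (rule dependent_nat_choice)
    have "infinite {n. \<sigma> n \<in> sym.mball p (inverse (real (Suc 0)))}" by (rule inf) simp
    then show "\<exists>n. \<sigma> n \<in> sym.mball p (inverse (real (Suc 0)))" by (rule not_finite_existsD)
    show "\<exists>m. \<sigma> m \<in> sym.mball p (inverse (real (Suc (Suc k)))) \<and> n < m" for n k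
    proof -
      have "infinite {n. \<sigma> n \<in> sym.mball p (inverse (real (Suc (Suc k))))}" by (rule inf) simp
      then show ?thesis unfolding infinite_nat_iff_unbounded mem_Collect_eq by meson
    qed
  qed
  then obtain r where r: "\<And>k. \<sigma> (r k) \<in> sym.mball p (inverse (real (Suc k)))" "\<And>k. r k < r (Suc k)"
    by blast
  have "converges (\<lambda>k. \<sigma> (r k)) p"
    unfolding sym.limit_metric_sequentially
  proof (intro conjI allI impI pM)
    fix e :: real assume "0 < e"
    then obtain N where N: "inverse (real (Suc N)) < e" using reals_Archimedean by blast
    have "\<sigma> (r n) \<in> M \<and> sdist (\<sigma> (r n)) p < e" if "N \<le> n" for n
    proof -
      have "inverse (real (Suc n)) \<le> inverse (real (Suc N))" using that by simp
      moreover have "\<sigma> (r n) \<in> M" "sdist (\<sigma> (r n)) p < inverse (real (Suc n))"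
        using r(1)[of n] by (simp_all add: sym.commute)
      ultimately show ?thesis using N by linarith
    qed
    then show "\<exists>N. \<forall>n\<ge>N. \<sigma> (r n) \<in> M \<and> sdist (\<sigma> (r n)) p < e" by blast
  qed
  moreover have "strict_mono r" using r(2) by (simp add: strict_mono_Suc_iff)
  ultimately show thesis by (rule that[rotated])
qed

end

section \<open>From oriented to two-sided equicontinuity\<close>

locale oriented_equicontinuous_family = generalized_metric_space M d
  for M :: "'a set" and d :: "'a \<Rightarrow> 'a \<Rightarrow> real" +
  fixes a b :: real and f :: "nat \<Rightarrow> real \<Rightarrow> 'a"
  assumes maps: "t \<in> {a..b} \<Longrightarrow> f n t \<in> M"
    and equi: "oriented_equicontinuous d a b f"
begin

lemma equiE:
  assumes "0 < e"
  obtains \<delta> where "0 < \<delta>"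
    "\<And>s t n. s \<in> {a..b} \<Longrightarrow> t \<in> {a..b} \<Longrightarrow> s \<le> t \<Longrightarrow> t - s < \<delta> \<Longrightarrow> d (f n s) (f n t) < e"
proof -
  obtain \<delta> where \<delta>: "0 < \<delta>" "\<forall>s\<in>{a..b}. \<forall>t\<in>{a..b}. 0 \<le> t - s \<and> t - s < \<delta> \<longrightarrow> (\<forall>n. d (f n s) (f n t) < e)"
    using equi assms unfolding oriented_equicontinuous_def by blast
  show thesis by (rule that[OF \<delta>(1)]) (use \<delta>(2) in auto)
qed

text \<open>For times before \<open>t\<close>, orientation bounds the distance from the value to
  \<open>y\<close>; for times after \<open>t\<close>, the distance from \<open>y\<close> to the
  value. By \<open>sdist_small\<close> at the fixed point \<open>y\<close>, either bound
  suffices.\<close>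

lemma converges_along:
  fixes n :: "nat \<Rightarrow> nat"
  assumes y: "converges (\<lambda>k. f (n k) t) y"
    and t: "t \<in> {a..b}" and x: "\<And>k. x k \<in> {a..b}" "x \<longlonglongrightarrow> t"
  shows "converges (\<lambda>k. f (n k) (x k)) y"
  unfolding sym.limit_metric_sequentially
proof (intro conjI allI impI)
  show yM: "y \<in> M" using limitin_topspace[OF y] by simp
  fix e :: real assume "0 < e"
  then obtain \<eta> where \<eta>: "0 < \<eta>" "\<And>z. z \<in> M \<Longrightarrow> d z y < \<eta> \<or> d y z < \<eta> \<Longrightarrow> sdist z y < e"
    using sdist_small[OF yM] by metis
  obtain \<delta> where \<delta>: "0 < \<delta>"
    "\<And>s t n. s \<in> {a..b} \<Longrightarrow> t \<in> {a..b} \<Longrightarrow> s \<le> t \<Longrightarrow> t - s < \<delta> \<Longrightarrow> d (f n s) (f n t) < \<eta> / 2"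
    using equiE[of "\<eta> / 2"] \<eta>(1) by auto
  obtain N1 where N1: "\<And>k. N1 \<le> k \<Longrightarrow> f (n k) t \<in> M \<and> sdist (f (n k) t) y < \<eta> / 2"
    using convergesE[OF y, of "\<eta> / 2"] \<eta>(1) by auto
  obtain N2 where N2: "\<And>k. N2 \<le> k \<Longrightarrow> \<bar>x k - t\<bar> < \<delta>"
    using LIMSEQ_D[OF x(2) \<delta>(1)] by auto
  have "f (n k) (x k) \<in> M \<and> sdist (f (n k) (x k)) y < e" if k: "max N1 N2 \<le> k" for k
  proof
    show M: "f (n k) (x k) \<in> M" by (rule maps[OF x(1)])
    have tM: "f (n k) t \<in> M" and ty: "d (f (n k) t) y < \<eta> / 2" "d y (f (n k) t) < \<eta> / 2"
      using N1[of k] k d_le_sdist[of "f (n k) t" y] d_le_sdist[of y "f (n k) t"] by (auto simp: sym.commute)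
    have "d (f (n k) (x k)) y < \<eta> \<or> d y (f (n k) (x k)) < \<eta>"
    proof (cases "x k \<le> t")
      case True
      then have "d (f (n k) (x k)) (f (n k) t) < \<eta> / 2" using N2[of k] k x(1) t by (intro \<delta>(2)) auto
      then show ?thesis using triangle[OF M tM yM] ty by auto
    next
      case False
      then have "d (f (n k) t) (f (n k) (x k)) < \<eta> / 2" using N2[of k] k x(1) t by (intro \<delta>(2)) auto
      then show ?thesis using triangle[OF yM tM M] ty by auto
    qed
    then show "sdist (f (n k) (x k)) y < e" using \<eta>(2)[OF M] by simp
  qed
  then show "\<exists>N. \<forall>k\<ge>N. f (n k) (x k) \<in> M \<and> sdist (f (n k) (x k)) y < e" by blast
qed

text \<open>Otherwise there are pairs of times arbitrarily close together with values at least
  \<open>e\<close> apart. Along a subsequence both times tend to one \<open>u\<close>, and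
  \<open>converges_along\<close> sends both values to the same \<open>y\<close>.\<close>

lemma equicontinuous_sdist:
  assumes rsc: "\<And>t. t \<in> {a..b} \<Longrightarrow> rel_seq_compact (\<lambda>n. f n t)" and e: "0 < e"
  obtains \<delta> where "0 < \<delta>"
    "\<And>s t n. s \<in> {a..b} \<Longrightarrow> t \<in> {a..b} \<Longrightarrow> \<bar>t - s\<bar> < \<delta> \<Longrightarrow> sdist (f n s) (f n t) < e"
proof -
  have "\<exists>\<delta>>0. \<forall>s\<in>{a..b}. \<forall>t\<in>{a..b}. \<forall>n. \<bar>t - s\<bar> < \<delta> \<longrightarrow> sdist (f n s) (f n t) < e"
  proof (rule ccontr)
    assume neg: "\<not> ?thesis"
    have "\<exists>s t n. s \<in> {a..b} \<and> t \<in> {a..b} \<and> \<bar>t - s\<bar> < inverse (real (Suc j)) \<and> \<not> sdist (f n s) (f n t) < e" for j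
    proof (rule ccontr)
      assume "\<not> ?thesis"
      then have "\<forall>s\<in>{a..b}. \<forall>t\<in>{a..b}. \<forall>n. \<bar>t - s\<bar> < inverse (real (Suc j)) \<longrightarrow> sdist (f n s) (f n t) < e"
        by blast
      moreover have "0 < inverse (real (Suc j))" by simp
      ultimately show False using neg by blast
    qed
    then obtain s t n where st: "\<And>j. s j \<in> {a..b}" "\<And>j. t j \<in> {a..b}"
      "\<And>j. \<bar>t j - s j\<bar> < inverse (real (Suc j))" and far: "\<And>j. \<not> sdist (f (n j) (s j)) (f (n j) (t j)) < e"
      by metis
    obtain u r where u: "u \<in> {a..b}" "strict_mono r" "(s \<circ> r) \<longlonglongrightarrow> u"
      using compact_Icc[of a b, unfolded compact_def] st(1) by metis
    have "(\<lambda>j. t j - s j) \<longlonglongrightarrow> 0"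
      using st(3) by (intro LIMSEQ_norm_0) (simp add: inverse_eq_divide)
    from tendsto_add[OF u(3) LIMSEQ_subseq_LIMSEQ[OF this u(2)]] have ut: "(t \<circ> r) \<longlonglongrightarrow> u"
      by (simp add: o_def)
    \<comment> \<open>The indices \<open>n j\<close> of the bad functions need not increase, or even
      be distinct; here compactness under arbitrary index maps is needed.\<close>
    obtain r' y where r': "strict_mono r'" "converges (\<lambda>k. f (n (r (r' k))) u) y"
      by (rule rel_seq_compactE[OF rsc[OF u(1)], of "\<lambda>k. n (r k)"])
    have "converges (\<lambda>k. f (n (r (r' k))) (s (r (r' k)))) y"
      using LIMSEQ_subseq_LIMSEQ[OF u(3) r'(1)]
      by (intro converges_along[OF r'(2) u(1)] st) (simp add: o_def)
    then obtain N1 where N1: "\<And>k. N1 \<le> k \<Longrightarrow> f (n (r (r' k))) (s (r (r' k))) \<in> M \<and>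
        sdist (f (n (r (r' k))) (s (r (r' k)))) y < e / 2"
      by (rule convergesE[of _ y "e / 2"]) (use e in auto)
    have yt: "converges (\<lambda>k. f (n (r (r' k))) (t (r (r' k)))) y"
      using LIMSEQ_subseq_LIMSEQ[OF ut r'(1)]
      by (intro converges_along[OF r'(2) u(1)] st) (simp add: o_def)
    then obtain N2 where N2: "\<And>k. N2 \<le> k \<Longrightarrow> f (n (r (r' k))) (t (r (r' k))) \<in> M \<and>
        sdist (f (n (r (r' k))) (t (r (r' k)))) y < e / 2"
      by (rule convergesE[of _ y "e / 2"]) (use e in auto)
    define k where "k = r (r' (max N1 N2))"
    have "y \<in> M" using limitin_topspace[OF yt] by simp
    then have "sdist (f (n k) (s k)) (f (n k) (t k)) \<le> sdist (f (n k) (s k)) y + sdist (f (n k) (t k)) y"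
      by (intro sym.triangle') (auto intro: maps st)
    then show False
      using far[of k] N1[of "max N1 N2"] N2[of "max N1 N2"] by (simp add: k_def)
  qed
  then show thesis using that by blast
qed

section \<open>Propagating relative compactness from \<open>a\<close> over the interval\<close>

text \<open>Compact neighbourhoods of the possible limits at \<open>t0\<close> have no common size a
  priori. Compactness of the values at \<open>t0\<close> reduces a failure at every
  \<open>\<delta>\<close> to a single limit, where one neighbourhood suffices.\<close>

lemma rel_seq_compact_right:
  assumes lc: "locally_compact_space sym.mtopology"
    and t0: "t0 \<in> {a..b}" and rsc: "rel_seq_compact (\<lambda>n. f n t0)"
  obtains \<delta> where "0 < \<delta>"
    "\<And>t. t \<in> {a..b} \<Longrightarrow> t0 \<le> t \<Longrightarrow> t < t0 + \<delta> \<Longrightarrow> rel_seq_compact (\<lambda>n. f n t)"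
proof -
  have "\<exists>\<delta>>0. \<forall>t\<in>{a..b}. t0 \<le> t \<and> t < t0 + \<delta> \<longrightarrow> rel_seq_compact (\<lambda>n. f n t)"
  proof (rule ccontr)
    assume neg: "\<not> ?thesis"
    \<comment> \<open>Thin the bad index sequences so that their values at t0 are clustered; then the first
      of these values converge along a subsequence to some z, and a compact neighbourhood of z
      captures all values at a bad point.\<close>
    have "\<exists>s q. s \<in> {a..b} \<and> t0 \<le> s \<and> s < t0 + inverse (real (Suc j)) \<and>
        (\<forall>k. sdist (f (q 0) t0) (f (q k) t0) < inverse (real (Suc j))) \<and>
        \<not> rel_seq_compact (\<lambda>k. f (q k) s)" for j
    proof -
      have j: "0 < inverse (real (Suc j))" by simp
      with neg obtain s where s: "s \<in> {a..b}" "t0 \<le> s" "s < t0 + inverse (real (Suc j))"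
        "\<not> rel_seq_compact (\<lambda>n. f n s)" by blast
      then obtain n :: "nat \<Rightarrow> nat" where n: "\<And>r l. strict_mono r \<Longrightarrow> \<not> converges (\<lambda>k. f (n (r k)) s) l"
        unfolding rel_seq_compact_def by auto
      obtain r l where r: "strict_mono r" "converges (\<lambda>k. f (n (r k)) t0) l"
        by (rule rel_seq_compactE[OF rsc, of n])
      obtain N where N: "\<And>k. N \<le> k \<Longrightarrow> f (n (r k)) t0 \<in> M \<and>
          sdist (f (n (r k)) t0) l < inverse (real (Suc j)) / 2"
        by (rule convergesE[OF r(2), of "inverse (real (Suc j)) / 2"]) (use j in auto)
      \<comment> \<open>Past \<open>N\<close> all values at \<open>t0\<close> are within half the
        tolerance of \<open>l\<close>, hence within the full tolerance of the first one
        kept.\<close>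
      define q where "q k = n (r (N + k))" for k
      have "l \<in> M" using limitin_topspace[OF r(2)] by simp
      have "sdist (f (q 0) t0) (f (q k) t0) < inverse (real (Suc j))" for k
        using sym.triangle'[of "f (q 0) t0" l "f (q k) t0"] N[of N] N[of "N + k"] \<open>l \<in> M\<close>
        by (simp add: q_def)
      moreover have "\<not> rel_seq_compact (\<lambda>k. f (q k) s)"
      proof
        assume "rel_seq_compact (\<lambda>k. f (q k) s)"
        then obtain r' l' where r': "strict_mono r'" "converges (\<lambda>k. f (q (r' k)) s) l'"
          by (rule rel_seq_compactE[of _ "\<lambda>k. k"])
        have "strict_mono (\<lambda>k. r (N + r' k))"
          using r(1) r'(1) by (simp add: strict_mono_def)
        from n[OF this] r'(2) show False by (simp add: q_def)
      qed
      ultimately show ?thesis using s by blast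
    qed
    then obtain s q where s: "\<And>j. s j \<in> {a..b}" "\<And>j. t0 \<le> s j" "\<And>j. s j < t0 + inverse (real (Suc j))"
      and q: "\<And>j k. sdist (f (q j 0) t0) (f (q j k) t0) < inverse (real (Suc j))"
      and bad: "\<And>j. \<not> rel_seq_compact (\<lambda>k. f (q j k) (s j))"
      by metis
    obtain r z where r: "strict_mono r" "converges (\<lambda>k. f (q (r k) 0) t0) z"
      by (rule rel_seq_compactE[OF rsc, of "\<lambda>j. q j 0"])
    have zM: "z \<in> M" using limitin_topspace[OF r(2)] by simp
    then obtain U K where UK: "openin sym.mtopology U" "compactin sym.mtopology K" "z \<in> U" "U \<subseteq> K"
      using lc unfolding locally_compact_space_def by auto
    then obtain \<rho> where \<rho>: "0 < \<rho>" "forward_ball M d z \<rho> \<subseteq> K"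
      unfolding gm_topology_eq[symmetric] openin_gm_topology by blast
    obtain \<delta> where \<delta>: "0 < \<delta>"
      "\<And>s t n. s \<in> {a..b} \<Longrightarrow> t \<in> {a..b} \<Longrightarrow> s \<le> t \<Longrightarrow> t - s < \<delta> \<Longrightarrow> d (f n s) (f n t) < \<rho> / 3"
      using equiE[of "\<rho> / 3"] \<rho>(1) by auto
    obtain N1 where N1: "\<And>k. N1 \<le> k \<Longrightarrow> f (q (r k) 0) t0 \<in> M \<and> sdist (f (q (r k) 0) t0) z < \<rho> / 3"
      by (rule convergesE[OF r(2), of "\<rho> / 3"]) (use \<rho> in auto)
    obtain N2 where N2: "inverse (real (Suc N2)) < min \<delta> (\<rho> / 3)"
      using reals_Archimedean[of "min \<delta> (\<rho> / 3)"] \<rho> \<delta> by auto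
    \<comment> \<open>A strictly increasing \<open>r\<close> satisfies k \<le> \<open>r k\<close>,
      so this \<open>j\<close> is at least \<open>N2\<close> while \<open>q j 0\<close> still gives
      a value near \<open>z\<close>.\<close>
    define j where "j = r (max N1 N2)"
    have "N2 \<le> j" using seq_suble[OF r(1), of "max N1 N2"] by (simp add: j_def)
    then have "inverse (real (Suc j)) \<le> inverse (real (Suc N2))" by simp
    with N2 have j: "inverse (real (Suc j)) < \<delta>" "inverse (real (Suc j)) < \<rho> / 3" by linarith+
    \<comment> \<open>Three forward steps of length below \<open>\<rho>\<close>/3: from
      \<open>z\<close> to the first value at \<open>t0\<close>, on to the \<open>k\<close>-th value
      at \<open>t0\<close>, then forward in time to \<open>s j\<close>.\<close>
    have "f (q j k) (s j) \<in> K" for k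
    proof -
      have M: "f (q j 0) t0 \<in> M" "f (q j k) t0 \<in> M" "f (q j k) (s j) \<in> M" using maps t0 s(1) by auto
      have "d z (f (q j 0) t0) < \<rho> / 3"
        using N1[of "max N1 N2"] d_le_sdist(2)[of z "f (q j 0) t0"] by (simp add: j_def)
      moreover have "d (f (q j 0) t0) (f (q j k) t0) < \<rho> / 3"
        using d_le_sdist(1)[of "f (q j 0) t0" "f (q j k) t0"] q[of j k] j(2) by linarith
      moreover have "d (f (q j k) t0) (f (q j k) (s j)) < \<rho> / 3"
        using \<delta>(2)[OF t0 s(1)[of j] s(2)[of j]] s(3)[of j] j(1) by simp
      ultimately have "d z (f (q j k) (s j)) < \<rho>"
        using triangle[OF zM M(1) M(2)] triangle[OF zM M(2) M(3)] by linarith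
      then show ?thesis using \<rho>(2) M(3) by (auto simp: forward_ball_def)
    qed
    then show False using rel_seq_compact_if_compactin[OF UK(2), of "\<lambda>k. f (q j k) (s j)"] bad[of j] by simp
  qed
  then show thesis using that by blast
qed

text \<open>Increasing times match the orientation: the limits at these times form a forward Cauchy
  sequence, whose limit \<open>z\<close> exists by completeness. Going from \<open>z\<close> through
  a late \<open>y j\<close> reaches the values at \<open>t\<close> in the forward direction.\<close>

lemma rel_seq_compact_left:
  assumes fc: "forward_complete M d" and t: "t \<in> {a..b}"
    and x: "\<And>j. x j \<in> {a..b}" "\<And>j. x j \<le> t" "mono x" "x \<longlonglongrightarrow> t"
    and rsc: "\<And>j. rel_seq_compact (\<lambda>n. f n (x j))"
  shows "rel_seq_compact (\<lambda>n. f n t)"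
  unfolding rel_seq_compact_def
proof
  fix n :: "nat \<Rightarrow> nat"
  obtain r y where r: "strict_mono r" and "\<forall>j. converges (\<lambda>k. f (n (r k)) (x j)) (y j)"
    using diagonal_subseq[of "\<lambda>j n. f n (x j)" n, OF rsc] by (elim exE conjE)
  then have y: "converges (\<lambda>k. f (n (r k)) (x j)) (y j)" for j by (elim allE)
  have yM: "y j \<in> M" for j using limitin_topspace[OF y] by simp
  \<comment> \<open>A bound valid for every index passes to the limits: replacing each limit by a
    value of late index costs h/2 at either end.\<close>
  have yy: "d (y i) (y j) \<le> e"
    if "\<And>n. d (f n (x i)) (f n (x j)) \<le> e" for i j e
  proof (rule field_le_epsilon)
    fix h :: real assume h: "0 < h"
    obtain N1 where N1: "\<And>k. N1 \<le> k \<Longrightarrow> f (n (r k)) (x i) \<in> M \<and> sdist (f (n (r k)) (x i)) (y i) < h / 2"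
      by (rule convergesE[OF y, of "h / 2" i]) (use h in auto)
    obtain N2 where N2: "\<And>k. N2 \<le> k \<Longrightarrow> f (n (r k)) (x j) \<in> M \<and> sdist (f (n (r k)) (x j)) (y j) < h / 2"
      by (rule convergesE[OF y, of "h / 2" j]) (use h in auto)
    define p where "p = n (r (max N1 N2))"
    have "f p (x i) \<in> M" "d (y i) (f p (x i)) < h / 2"
      using N1[of "max N1 N2"] d_le_sdist(2)[of "y i" "f p (x i)"] by (auto simp: p_def)
    moreover have "f p (x j) \<in> M" "d (f p (x j)) (y j) < h / 2"
      using N2[of "max N1 N2"] d_le_sdist(1)[of "f p (x j)" "y j"] by (auto simp: p_def)
    ultimately show "d (y i) (y j) \<le> e + h"
      using that[of p] triangle[OF yM[of i] _ yM[of j], of "f p (x i)"]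
        triangle[of "f p (x i)" "f p (x j)" "y j"] yM by fastforce
  qed
  have "forward_Cauchy d y"
    unfolding forward_Cauchy_def
  proof (intro allI impI)
    fix e :: real assume e: "0 < e"
    then obtain \<delta> where \<delta>: "0 < \<delta>"
      "\<And>s t n. s \<in> {a..b} \<Longrightarrow> t \<in> {a..b} \<Longrightarrow> s \<le> t \<Longrightarrow> t - s < \<delta> \<Longrightarrow> d (f n s) (f n t) < e / 2"
      using equiE[of "e / 2"] by auto
    obtain N where N: "\<And>k. N \<le> k \<Longrightarrow> \<bar>x k - t\<bar> < \<delta>"
      using LIMSEQ_D[OF x(4) \<delta>(1)] by auto
    have "d (y i) (y j) < e" if ij: "N \<le> i" "i \<le> j" for i j
    proof -
      have "d (y i) (y j) \<le> e / 2"
      proof (rule yy[OF less_imp_le], rule \<delta>(2))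
        show "x i \<le> x j" by (rule monoD[OF x(3) ij(2)])
        show "x j - x i < \<delta>" using N[of i] x(2)[of i] x(2)[of j] ij by auto
      qed (rule x(1))+
      then show ?thesis using e by simp
    qed
    then show "\<exists>n0. \<forall>i j. n0 \<le> i \<and> i \<le> j \<longrightarrow> d (y i) (y j) < e" by blast
  qed
  moreover have "range y \<subseteq> M" using yM by auto
  ultimately obtain z where z: "converges y z"
    using fc unfolding forward_complete_def gm_topology_eq by blast
  have zM: "z \<in> M" using limitin_topspace[OF z] by simp
  have "converges (\<lambda>k. f (n (r k)) t) z"
    unfolding sym.limit_metric_sequentially
  proof (intro conjI allI impI zM)
    fix e :: real assume "0 < e"
    then obtain \<eta> where \<eta>: "0 < \<eta>" "\<And>u. u \<in> M \<Longrightarrow> d u z < \<eta> \<or> d z u < \<eta> \<Longrightarrow> sdist u z < e"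
      using sdist_small[OF zM] by metis
    obtain \<delta> where \<delta>: "0 < \<delta>"
      "\<And>s t n. s \<in> {a..b} \<Longrightarrow> t \<in> {a..b} \<Longrightarrow> s \<le> t \<Longrightarrow> t - s < \<delta> \<Longrightarrow> d (f n s) (f n t) < \<eta> / 3"
      using equiE[of "\<eta> / 3"] \<eta>(1) by auto
    obtain N1 where N1: "\<And>k. N1 \<le> k \<Longrightarrow> \<bar>x k - t\<bar> < \<delta>"
      using LIMSEQ_D[OF x(4) \<delta>(1)] by auto
    obtain N2 where N2: "\<And>k. N2 \<le> k \<Longrightarrow> y k \<in> M \<and> sdist (y k) z < \<eta> / 3"
      by (rule convergesE[OF z, of "\<eta> / 3"]) (use \<eta> in auto)
    \<comment> \<open>The time \<open>x j\<close> is fixed first, since the index threshold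
      \<open>N\<close> below depends on it.\<close>
    define j where "j = max N1 N2"
    obtain N where N: "\<And>k. N \<le> k \<Longrightarrow> f (n (r k)) (x j) \<in> M \<and> sdist (f (n (r k)) (x j)) (y j) < \<eta> / 3"
      by (rule convergesE[OF y, of "\<eta> / 3" j]) (use \<eta> in auto)
    have "f (n (r k)) t \<in> M \<and> sdist (f (n (r k)) t) z < e" if k: "N \<le> k" for k
    proof
      show M: "f (n (r k)) t \<in> M" by (rule maps[OF t])
      have jM: "f (n (r k)) (x j) \<in> M" by (rule maps[OF x(1)])
      have "d z (y j) < \<eta> / 3" using N2[of j] d_le_sdist(2)[of z "y j"] by (simp add: j_def)
      moreover have "d (y j) (f (n (r k)) (x j)) < \<eta> / 3"
        using N[OF k] d_le_sdist(2)[of "y j" "f (n (r k)) (x j)"] by simp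
      moreover have "d (f (n (r k)) (x j)) (f (n (r k)) t) < \<eta> / 3"
        using N1[of j] x(2)[of j] by (intro \<delta>(2) x t) (auto simp: j_def)
      \<comment> \<open>Only the distance from \<open>z\<close> is controlled; the choice of
        \<open>\<eta>\<close> converts it into an \<open>sdist\<close> bound.\<close>
      ultimately have "d z (f (n (r k)) t) < \<eta>"
        using triangle[OF zM yM[of j] jM] triangle[OF zM jM M] by linarith
      then show "sdist (f (n (r k)) t) z < e" using \<eta>(2)[OF M] by simp
    qed
    then show "\<exists>N. \<forall>k\<ge>N. f (n (r k)) t \<in> M \<and> sdist (f (n (r k)) t) z < e" by blast
  qed
  with r show "\<exists>r l. strict_mono (r :: nat \<Rightarrow> nat) \<and> converges (\<lambda>k. f (n (r k)) t) l" by (intro exI conjI)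
qed

text \<open>A supremum argument: \<open>rel_seq_compact_left\<close> makes the supremum
  \<open>c\<close> itself a good time, and \<open>rel_seq_compact_right\<close> would move past it
  if it were below \<open>b\<close>.\<close>

lemma rel_seq_compact_all:
  assumes fc: "forward_complete M d" and lc: "locally_compact_space sym.mtopology"
    and start: "rel_seq_compact (\<lambda>n. f n a)" and t: "t \<in> {a..b}"
  shows "rel_seq_compact (\<lambda>n. f n t)"
proof -
  \<comment> \<open>Demanding all times up to \<open>s\<close> makes \<open>S\<close> an initial
    segment, so every time below its supremum is good.\<close>
  define S where "S = {s \<in> {a..b}. \<forall>u\<in>{a..s}. rel_seq_compact (\<lambda>n. f n u)}"
  define c where "c = Sup S"
  have aS: "a \<in> S" using start t by (auto simp: S_def)
  have bdd: "bdd_above S" by (rule bdd_aboveI[of _ b]) (simp add: S_def)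
  have ac: "a \<le> c" unfolding c_def by (rule cSup_upper[OF aS bdd])
  have cb: "c \<le> b" unfolding c_def by (rule cSup_least) (use aS in \<open>auto simp: S_def\<close>)
  have below: "rel_seq_compact (\<lambda>n. f n u)" if u: "a \<le> u" "u < c" for u
  proof -
    obtain s where "s \<in> S" "u < s" using u(2) less_cSup_iff[OF _ bdd] aS by (auto simp: c_def)
    then show ?thesis using u by (auto simp: S_def)
  qed
  have atc: "rel_seq_compact (\<lambda>n. f n c)"
  proof (cases "a = c")
    case True then show ?thesis using start by simp
  next
    case False
    \<comment> \<open>These times increase from \<open>x 0\<close> = \<open>a\<close> to
      \<open>c\<close> without reaching it, so \<open>below\<close> applies to each.\<close>
    define x where "x j = c - (c - a) * inverse (real (Suc j))" for j
    have inv: "0 < inverse (real (Suc j))" "inverse (real (Suc j)) \<le> 1" for j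
      by (auto simp: inverse_le_1_iff)
    have "0 < c - a" using ac False by simp
    then have "0 < (c - a) * inverse (real (Suc j))" "(c - a) * inverse (real (Suc j)) \<le> c - a" for j
      using inv[of j] by (simp_all only: mult_pos_pos mult_left_le less_imp_le)
    note step = this
    have x: "a \<le> x j" "x j < c" for j using step[of j] unfolding x_def by linarith+
    show ?thesis
    proof (rule rel_seq_compact_left[OF fc])
      have "(\<lambda>j. c - (c - a) * inverse (real (Suc j))) \<longlonglongrightarrow> c - (c - a) * 0"
        by (intro tendsto_intros LIMSEQ_inverse_real_of_nat)
      then show "x \<longlonglongrightarrow> c" by (simp add: x_def[abs_def])
      show "mono x"
        using ac by (auto simp: mono_def x_def intro!: mult_left_mono)
      show "x j \<in> {a..b}" "x j \<le> c" for j using x[of j] cb by auto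
      show "rel_seq_compact (\<lambda>n. f n (x j))" for j using x[of j] by (rule below)
    qed (use ac cb in simp)
  qed
  obtain \<delta> where \<delta>: "0 < \<delta>"
    "\<And>t. t \<in> {a..b} \<Longrightarrow> c \<le> t \<Longrightarrow> t < c + \<delta> \<Longrightarrow> rel_seq_compact (\<lambda>n. f n t)"
    using rel_seq_compact_right[OF lc _ atc] ac cb by auto
  have "c = b"
  proof (rule ccontr)
    assume "c \<noteq> b"
    \<comment> \<open>Halving \<open>\<delta>\<close> keeps \<open>s\<close> strictly within the
      range of the right step, and \<open>c\<close> below \<open>b\<close> makes \<open>s\<close>
      exceed \<open>c\<close>.\<close>
    define s where "s = min b (c + \<delta> / 2)"
    have s: "c < s" "s \<le> b" "s < c + \<delta>" using \<delta>(1) cb \<open>c \<noteq> b\<close> by (auto simp: s_def)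
    have "rel_seq_compact (\<lambda>n. f n u)" if "u \<in> {a..s}" for u
      using that s below[of u] \<delta>(2)[of u] by (cases "u < c") auto
    then have "s \<in> S" using s ac by (auto simp: S_def)
    then have "s \<le> c" unfolding c_def by (rule cSup_upper[OF _ bdd])
    then show False using s by simp
  qed
  then show ?thesis using t below[of t] atc by (cases "t = b") auto
qed

section \<open>Arzela-Ascoli extraction and continuity of the limit\<close>

text \<open>A diagonal subsequence converges on a countable dense set of times, and equicontinuity
  makes it Cauchy at every other time. Relative compactness at that time supplies a convergent
  subsequence, hence the limit.\<close>

lemma convergent_subseq:
  assumes rsc: "\<And>t. t \<in> {a..b} \<Longrightarrow> rel_seq_compact (\<lambda>n. f n t)"
  shows "\<exists>(r :: nat \<Rightarrow> nat) g. strict_mono r \<and> (\<forall>t\<in>{a..b}. converges (\<lambda>k. f (r k) t) (g t))"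
proof (cases "a \<le> b")
  case False
  then show ?thesis by (intro exI[of _ id] exI[of _ "\<lambda>_. undefined"] conjI) (simp_all add: strict_mono_def)
next
  case True
  obtain C where C: "countable C" "C \<subseteq> {a..b}" "{a..b} \<subseteq> closure C"
    using separable[of "{a..b}"] by metis
  with True have "C \<noteq> {}" by auto
  \<comment> \<open>An enumeration with possible repetitions, which also covers a finite
    \<open>C\<close>, as when \<open>a\<close> = \<open>b\<close>.\<close>
  define x where "x = from_nat_into C"
  have x: "x j \<in> {a..b}" for j using subsetD[OF C(2) from_nat_into[OF \<open>C \<noteq> {}\<close>]] unfolding x_def .
  have rx: "range x = C" using range_from_nat_into[OF \<open>C \<noteq> {}\<close> C(1)] by (simp add: x_def)
  obtain r y where r: "strict_mono r" and "\<forall>j. converges (\<lambda>k. f (r k) (x j)) (y j)"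
    using diagonal_subseq[of "\<lambda>j n. f n (x j)" "\<lambda>k. k", OF rsc[OF x]] by (elim exE conjE)
  then have y: "converges (\<lambda>k. f (r k) (x j)) (y j)" for j by (elim allE)
  have "\<exists>l. converges (\<lambda>k. f (r k) t) l" if t: "t \<in> {a..b}" for t
  proof -
    have Cauchy: "sym.MCauchy (\<lambda>k. f (r k) t)"
      unfolding sym.MCauchy_def
    proof (intro conjI allI impI)
      show "range (\<lambda>k. f (r k) t) \<subseteq> M" using maps[OF t] by auto
      fix e :: real assume e: "0 < e"
      obtain \<delta> where \<delta>: "0 < \<delta>"
        "\<And>s t n. s \<in> {a..b} \<Longrightarrow> t \<in> {a..b} \<Longrightarrow> \<bar>t - s\<bar> < \<delta> \<Longrightarrow> sdist (f n s) (f n t) < e / 4"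
        by (rule equicontinuous_sdist[OF rsc, of "e / 4"]) (use e in auto)
      have "t \<in> closure C" using C(3) t by auto
      then obtain c where "c \<in> C" "dist c t < \<delta>" using \<delta>(1) unfolding closure_approachable by blast
      then obtain j where j: "\<bar>t - x j\<bar> < \<delta>" using rx by (auto simp: dist_real_def abs_minus_commute)
      obtain N where N: "\<And>k. N \<le> k \<Longrightarrow> f (r k) (x j) \<in> M \<and> sdist (f (r k) (x j)) (y j) < e / 4"
        by (rule convergesE[OF y, of "e / 4" j]) (use e in auto)
      have yM: "y j \<in> M" using limitin_topspace[OF y] by simp
      have "sdist (f (r k) t) (y j) < e / 2" if "N \<le> k" for k
        using sym.triangle[of "f (r k) t" "f (r k) (x j)" "y j"] N[OF that] \<delta>(2)[OF x t j, of "r k"] maps[OF t] yM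
        by (simp add: sym.commute[of "f (r k) t" "f (r k) (x j)"])
      note near = this
      have "sdist (f (r k) t) (f (r k') t) < e" if "N \<le> k" "N \<le> k'" for k k'
        using sym.triangle'[OF maps[OF t] yM maps[OF t], of "r k" "r k'"] near[OF that(1)] near[OF that(2)]
        by linarith
      then show "\<exists>N. \<forall>n n'. N \<le> n \<longrightarrow> N \<le> n' \<longrightarrow> sdist (f (r n) t) (f (r n') t) < e" by blast
    qed
    obtain r' l where r': "strict_mono r'" "converges (\<lambda>k. f (r (r' k)) t) l"
      by (rule rel_seq_compactE[OF rsc[OF t], of r])
    have "converges ((\<lambda>k. f (r k) t) \<circ> r') l" unfolding comp_def by (rule r'(2))
    then have "converges (\<lambda>k. f (r k) t) l"
      by (rule sym.MCauchy_convergent_subsequence[OF Cauchy r'(1)])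
    then show ?thesis by (rule exI)
  qed
  then have "\<forall>t\<in>{a..b}. \<exists>l. converges (\<lambda>k. f (r k) t) l" by blast
  then have "\<exists>g. \<forall>t\<in>{a..b}. converges (\<lambda>k. f (r k) t) (g t)" by (rule bchoice)
  then obtain g where "\<forall>t\<in>{a..b}. converges (\<lambda>k. f (r k) t) (g t)" by (elim exE)
  with r show ?thesis by (intro exI[of _ r] exI[of _ g] conjI)
qed

text \<open>The usual e/3 estimate: at a late common index \<open>p\<close> the values at
  \<open>s\<close> and \<open>t\<close> are near their limits, and near each other by
  equicontinuity.\<close>

lemma limit_continuous:
  fixes r :: "nat \<Rightarrow> nat"
  assumes rsc: "\<And>t. t \<in> {a..b} \<Longrightarrow> rel_seq_compact (\<lambda>n. f n t)"
    and g: "\<And>t. t \<in> {a..b} \<Longrightarrow> converges (\<lambda>k. f (r k) t) (g t)"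
  shows "continuous_map (top_of_set {a..b}) sym.mtopology g"
proof -
  have gM: "g t \<in> M" if "t \<in> {a..b}" for t using limitin_topspace[OF g[OF that]] by simp
  show ?thesis
    unfolding sym.continuous_map_to_metric
  proof (intro ballI allI impI)
    fix t e :: real assume "t \<in> topspace (top_of_set {a..b})" and e: "0 < e"
    then have t: "t \<in> {a..b}" by simp
    obtain \<delta> where \<delta>: "0 < \<delta>"
      "\<And>s t n. s \<in> {a..b} \<Longrightarrow> t \<in> {a..b} \<Longrightarrow> \<bar>t - s\<bar> < \<delta> \<Longrightarrow> sdist (f n s) (f n t) < e / 3"
      by (rule equicontinuous_sdist[OF rsc, of "e / 3"]) (use e in auto)
    have "g s \<in> sym.mball (g t) e" if s: "s \<in> {a..b}" "\<bar>s - t\<bar> < \<delta>" for s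
    proof -
      obtain N1 where N1: "\<And>k. N1 \<le> k \<Longrightarrow> f (r k) s \<in> M \<and> sdist (f (r k) s) (g s) < e / 3"
        by (rule convergesE[OF g[OF s(1)], of "e / 3"]) (use e in auto)
      obtain N2 where N2: "\<And>k. N2 \<le> k \<Longrightarrow> f (r k) t \<in> M \<and> sdist (f (r k) t) (g t) < e / 3"
        by (rule convergesE[OF g[OF t], of "e / 3"]) (use e in auto)
      define p where "p = r (max N1 N2)"
      have "sdist (f p s) (g s) < e / 3" "sdist (g t) (f p t) < e / 3" "sdist (f p t) (f p s) < e / 3"
        using N1[of "max N1 N2"] N2[of "max N1 N2"] \<delta>(2)[OF t s, of p]
        by (auto simp: p_def sym.commute[of "g t"])
      then have "sdist (g t) (g s) < e"
        using sym.triangle[OF gM[OF t] maps[OF t] maps[OF s(1)], of p p]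
          sym.triangle[OF gM[OF t] maps[OF s(1)] gM[OF s(1)], of p] by linarith
      then show ?thesis using gM s t by simp
    qed
    then show "\<exists>U. openin (top_of_set {a..b}) U \<and> t \<in> U \<and> (\<forall>s\<in>U. g s \<in> sym.mball (g t) e)"
      using \<delta>(1) t
      by (intro exI[of _ "{a..b} \<inter> ball t \<delta>"]) (auto simp: dist_real_def abs_minus_commute)
  qed
qed

end

theorem theorem5p15:
  fixes M :: "'a set" and d :: "'a \<Rightarrow> 'a \<Rightarrow> real"
    and a b :: real and f :: "nat \<Rightarrow> real \<Rightarrow> 'a"
  assumes "generalized_metric_space M d"
    and "a \<le> b"
    and "\<And>n. f n \<in> {a..b} \<rightarrow> M"
    and "oriented_equicontinuous d a b f"
    and "\<exists>p. seq_accumulation_point (gm_topology M d) (\<lambda>n. f n a) p"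
    and "locally_compact_space (gm_topology M d)"
    and "forward_complete M d"
  shows "\<exists>g r. continuous_map (top_of_set {a..b}) (gm_topology M d) g
    \<and> strict_mono (r :: nat \<Rightarrow> nat)
    \<and> equicontinuous d a b (\<lambda>k. f (r k))
    \<and> (\<forall>t\<in>{a..b}. limitin (gm_topology M d) (\<lambda>k. f (r k) t) (g t) sequentially)"
proof -
  interpret generalized_metric_space M d by fact
  obtain p where p: "seq_accumulation_point (gm_topology M d) (\<lambda>n. f n a) p" using assms(5) by (elim exE)
  obtain r0 where r0: "strict_mono r0" "converges (\<lambda>k. f (r0 k) a) p"
    by (rule accumulation_point_subseq[OF p])
  \<comment> \<open>An accumulation point alone need not make all values at \<open>a\<close>
    relatively compact; a subsequence converging there does, and it inherits oriented
    equicontinuity.\<close>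
  define h where "h k = f (r0 k)" for k
  interpret oriented_equicontinuous_family M d a b h
  proof
    show "h n t \<in> M" if "t \<in> {a..b}" for n t unfolding h_def by (rule funcset_mem[OF assms(3) that])
    show "oriented_equicontinuous d a b h"
      using assms(4) unfolding oriented_equicontinuous_def h_def by meson
  qed
  have "rel_seq_compact (\<lambda>n. h n a)"
    using r0(2) maps[of a] \<open>a \<le> b\<close> by (intro rel_seq_compact_if_converges[where x = p]) (auto simp: h_def)
  then have rsc: "rel_seq_compact (\<lambda>n. h n t)" if "t \<in> {a..b}" for t
    using rel_seq_compact_all assms(6,7) that by (simp add: gm_topology_eq)
  obtain r g where r: "strict_mono r" and g': "\<forall>t\<in>{a..b}. converges (\<lambda>k. h (r k) t) (g t)"
  proof -
    have "\<exists>(r :: nat \<Rightarrow> nat) g. strict_mono r \<and> (\<forall>t\<in>{a..b}. converges (\<lambda>k. h (r k) t) (g t))"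
      by (rule convergent_subseq) (rule rsc)
    then show ?thesis using that by (elim exE conjE)
  qed
  have g: "converges (\<lambda>k. h (r k) t) (g t)" if "t \<in> {a..b}" for t
    by (rule bspec[OF g' that])
  have "equicontinuous d a b (\<lambda>k. h (r k))"
    unfolding equicontinuous_def
  proof (intro allI impI)
    fix e :: real assume e: "0 < e"
    obtain \<delta> where \<delta>: "0 < \<delta>"
      "\<And>s t n. s \<in> {a..b} \<Longrightarrow> t \<in> {a..b} \<Longrightarrow> \<bar>t - s\<bar> < \<delta> \<Longrightarrow> sdist (h n s) (h n t) < e"
      by (rule equicontinuous_sdist[OF rsc, of e]) (use e in auto)
    then show "\<exists>\<delta>>0. \<forall>s\<in>{a..b}. \<forall>t\<in>{a..b}. 0 \<le> \<bar>t - s\<bar> \<and> \<bar>t - s\<bar> < \<delta> \<longrightarrow> (\<forall>n. d (h (r n) s) (h (r n) t) < e)"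
      using le_less_trans[OF d_le_sdist(1)] by (intro exI[of _ \<delta>]) auto
  qed
  moreover have "strict_mono (\<lambda>k. r0 (r k))" using r0(1) r by (simp add: strict_mono_def)
  moreover have "continuous_map (top_of_set {a..b}) sym.mtopology g"
    by (rule limit_continuous[OF rsc g])
  ultimately show ?thesis
    using g unfolding gm_topology_eq h_def
    by (intro exI[of _ g] exI[of _ "\<lambda>k. r0 (r k)"] conjI ballI)
qed

end
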